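(* For every integer $k\ge 5$, the graph $G_k$ obtained from the complete graph $K_k$ by subdividing every edge into a path of two edges satisfies $\bar\theta(G_k)=2$, where $\bar\theta$ denotes geometric thickness.
   Context: The graph $G_k$ is formed from the complete $k$-vertex graph $K_k$ by subdividing every edge into a path of two edges. Equivalently, the vertices of $G_k$ are the one-element and two-element subsets of a $k$-element set, with an edge between two distinct such subsets exactly when one is contained in the other. Thus $G_k$ has $k+\binom{k}{2}$ vertices and $2\binom{k}{2}$ edges. A straight-line drawing of a graph places the vertices at distinct points of the plane $\mathbb{R}^2$ and draws each edge as the straight line segment between the points representing its endpoints (with the usual convention that an edge passes through no vertex other than its own endpoints). Two edges cross if their segments share a point that is not a common endpoint of the two edges. The geometric thickness $\bar\theta(G)$ of a graph $G$ is the minimum number of layers in a straight-line drawing of $G$ in the plane in which each edge is assigned to a single layer and no two edges in the same layer cross. (Edges in different layers may cross; the vertex positions are the same for all layers.) *)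

theory Defs
  imports "HOL-Analysis.Analysis"
begin

text \<open>A graph is a pair of a vertex set and a set of edges, each edge being the set of its two
  endpoints.\<close>

type_synonym 'v graph = "'v set \<times> 'v set set"

abbreviation verts :: "'v graph \<Rightarrow> 'v set" where "verts \<equiv> fst"

abbreviation edges :: "'v graph \<Rightarrow> 'v set set" where "edges \<equiv> snd"

definition complete_graph :: "nat \<Rightarrow> nat graph" where
  "complete_graph k = ({..<k}, {e. e \<subseteq> {..<k} \<and> card e = 2})"

text \<open>Every edge is replaced by a path of two edges. The original vertex \<open>v\<close> becomes the singleton
  \<open>{v}\<close>, and the new vertex in the middle of the edge \<open>e\<close> is the two-element set \<open>e\<close> itself.\<close>

definition subdivide :: "'v graph \<Rightarrow> 'v set graph" where
  "subdivide G =
    ((\<lambda>v. {v}) ` verts G \<union> edges G, {{{v}, e} | v e. e \<in> edges G \<and> v \<in> e})"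

definition subdivided_complete_graph :: "nat \<Rightarrow> nat set graph" where
  "subdivided_complete_graph k = subdivide (complete_graph k)"

text \<open>For an edge \<open>e = {u, v}\<close> this is the closed segment between \<open>p u\<close> and \<open>p v\<close>.\<close>

definition edge_segment :: "('v \<Rightarrow> real \<times> real) \<Rightarrow> 'v set \<Rightarrow> (real \<times> real) set" where
  "edge_segment p e = convex hull (p ` e)"

lemma edge_segment_pair: "edge_segment p {u, v} = closed_segment (p u) (p v)"
  by (simp add: edge_segment_def segment_convex_hull)

definition straight_line_drawing :: "'v graph \<Rightarrow> ('v \<Rightarrow> real \<times> real) \<Rightarrow> bool" where
  "straight_line_drawing G p \<longleftrightarrow>
    inj_on p (verts G) \<and> (\<forall>e\<in>edges G. \<forall>w\<in>verts G - e. p w \<notin> edge_segment p e)"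

definition edges_cross :: "('v \<Rightarrow> real \<times> real) \<Rightarrow> 'v set \<Rightarrow> 'v set \<Rightarrow> bool" where
  "edges_cross p e f \<longleftrightarrow> (\<exists>x \<in> edge_segment p e \<inter> edge_segment p f. x \<notin> p ` (e \<inter> f))"

definition layering ::
  "'v graph \<Rightarrow> ('v \<Rightarrow> real \<times> real) \<Rightarrow> nat \<Rightarrow> ('v set \<Rightarrow> nat) \<Rightarrow> bool" where
  "layering G p t l \<longleftrightarrow>
    (\<forall>e\<in>edges G. l e < t) \<and>
    (\<forall>e\<in>edges G. \<forall>f\<in>edges G. e \<noteq> f \<and> l e = l f \<longrightarrow> \<not> edges_cross p e f)"

definition geometric_thickness :: "'v graph \<Rightarrow> nat" where
  "geometric_thickness G = (LEAST t. \<exists>p l. straight_line_drawing G p \<and> layering G p t l)"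

lemma verts_subdivided_complete_graph:
  "verts (subdivided_complete_graph k) = {S. S \<subseteq> {..<k} \<and> (card S = 1 \<or> card S = 2)}"
  by (auto simp: subdivided_complete_graph_def subdivide_def complete_graph_def card_1_singleton_iff)

lemma edges_subdivided_complete_graph:
  "edges (subdivided_complete_graph k) =
    {{S, T} | S T. S \<in> verts (subdivided_complete_graph k) \<and>
      T \<in> verts (subdivided_complete_graph k) \<and> S \<subset> T}" (is "?L = ?R")
proof -
  have L: "?L = {{{v}, e} | v e. (e \<subseteq> {..<k} \<and> card e = 2) \<and> v \<in> e}"
    by (simp add: subdivided_complete_graph_def subdivide_def complete_graph_def)
  show ?thesis
  proof (intro equalityI subsetI)
    fix x assume "x \<in> ?L"
    then obtain v e where x: "x = {{v}, e}" and e: "e \<subseteq> {..<k}" "card e = 2" and v: "v \<in> e"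
      unfolding L by blast
    have "{v} \<noteq> e" using e(2) by auto
    with v have "{v} \<subset> e" by blast
    moreover have "{v} \<in> verts (subdivided_complete_graph k)"
      "e \<in> verts (subdivided_complete_graph k)"
      using e v by (auto simp: verts_subdivided_complete_graph)
    ultimately show "x \<in> ?R" using x by blast
  next
    fix x assume "x \<in> ?R"
    then obtain S T where x: "x = {S, T}" and ST: "S \<subset> T"
      and "S \<in> verts (subdivided_complete_graph k)" "T \<in> verts (subdivided_complete_graph k)"
      by blast
    then have T: "T \<subseteq> {..<k}" and c: "card S = 1 \<or> card S = 2" "card T = 1 \<or> card T = 2"
      by (simp_all add: verts_subdivided_complete_graph)
    have "card S < card T"
      using ST T by (meson finite_lessThan finite_subset psubset_card_mono)
    with c have "card S = 1" "card T = 2" by linarith+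
    moreover from \<open>card S = 1\<close> obtain v where "S = {v}" by (rule card_1_singletonE)
    ultimately show "x \<in> ?L" unfolding L using x ST T by blast
  qed
qed

lemma card_verts_subdivided_complete_graph:
  "card (verts (subdivided_complete_graph k)) = k + (k choose 2)"
proof -
  define A where "A n = {S. S \<subseteq> {..<k} \<and> card S = n}" for n
  have "finite (A n)" "card (A n) = k choose n" for n
    unfolding A_def using n_subsets[of "{..<k}" n] by simp_all
  moreover have "verts (subdivided_complete_graph k) = A 1 \<union> A 2" "A 1 \<inter> A 2 = {}"
    unfolding verts_subdivided_complete_graph A_def by auto
  ultimately show ?thesis by (simp add: card_Un_disjoint)
qed

lemma card_edges_subdivided_complete_graph:
  "card (edges (subdivided_complete_graph k)) = 2 * (k choose 2)"
proof -
  define A where "A = {e. e \<subseteq> {..<k} \<and> card e = 2}"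
  have A: "finite A" "card A = k choose 2"
    unfolding A_def using n_subsets[of "{..<k}" 2] by simp_all
  have A2: "card e = 2" "finite e" if "e \<in> A" for e
    using that finite_subset[of e "{..<k}"] by (simp_all add: A_def)
  have "edges (subdivided_complete_graph k) = {{{v}, e} | v e. e \<in> A \<and> v \<in> e}"
    by (simp add: subdivided_complete_graph_def subdivide_def complete_graph_def A_def)
  also have "\<dots> = (\<lambda>x. {{snd x}, fst x}) ` Sigma A (\<lambda>e. e)"
    by (auto simp: image_def)
  also have "card \<dots> = card (Sigma A (\<lambda>e. e))"
  proof (intro card_image inj_onI)
    fix x y
    assume xy: "x \<in> Sigma A (\<lambda>e. e)" "y \<in> Sigma A (\<lambda>e. e)"
      and eq: "{{snd x}, fst x} = {{snd y}, fst y}"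
    have "card (fst x) = 2" using xy(1) A2 by auto
    then have "fst x \<noteq> {snd y}" by auto
    with eq show "x = y" by (simp add: doubleton_eq_iff prod_eq_iff)
  qed
  also have "\<dots> = (\<Sum>e\<in>A. card e)"
    using A A2 by (intro card_SigmaI) simp_all
  also have "\<dots> = 2 * (k choose 2)"
    using A A2 by simp
  finally show ?thesis .
qed

end

theory Submission
  imports Defs "HOL-Library.Z2" "HOL-Computational_Algebra.Polynomial"
begin

text \<open>Upper bound: place the vertex \<open>{i}\<close> at \<open>(i, i)\<close> and, for \<open>i < j\<close>, the middle vertex \<open>{i, j}\<close> near
  \<open>(i, j)\<close>. The edges from \<open>{i}\<close> to the vertices \<open>{i, j}\<close> with \<open>j > i\<close> form a star in a vertical
  strip at \<open>i\<close>, those from \<open>{j}\<close> to the vertices \<open>{i, j}\<close> with \<open>i < j\<close> a star in a horizontal strip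
  at \<open>j\<close>; so each of these two star forests is drawn without crossings once the perturbations give
  the edges of every star different directions.

  Lower bound: a one-layer drawing would be a crossing-free drawing of \<open>K\<^sub>5\<close> with one bend per
  edge. Only pairs of disjoint edges matter, so the points may be moved into general position. Modulo
  two, a segment crosses a triangle once for each of its ends inside the triangle. Hence straightening
  an edge changes the number of crossings with the triangle on the three remaining vertices of \<open>K\<^sub>5\<close> by
  an even number, while a straight-line drawing of \<open>K\<^sub>5\<close> in general position has an odd number of
  crossings.\<close>

section \<open>Crossing parities in general position\<close>

text \<open>Twice the signed area of the triangle \<open>a b c\<close>, positive for a
  counterclockwise turn.\<close>

definition orient :: "real \<times> real \<Rightarrow> real \<times> real \<Rightarrow> real \<times> real \<Rightarrow> real" where
  "orient a b c = (fst b - fst a) * (snd c - snd a) - (snd b - snd a) * (fst c - fst a)"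

lemma orient_rotate: "orient b c a = orient a b c"
  and orient_swap: "orient b a c = - orient a b c"
  unfolding orient_def by (simp_all add: algebra_simps)

lemma orient_swap_right: "orient a c b = - orient a b c"
  unfolding orient_def by (simp add: algebra_simps)

lemma orient_cocycle: "orient x y z = orient x y u + orient y z u + orient z x u"
  unfolding orient_def by (simp add: algebra_simps)

text \<open>The three-term Grassmann-Pluecker relation for the vectors from \<open>a\<close> to the
  other four points.\<close>

lemma orient_Pluecker:
  "orient a b c * orient a d e + orient a b e * orient a c d = orient a b d * orient a c e"
  unfolding orient_def by (simp add: algebra_simps)

lemma closed_segments_meet:
  assumes "orient a b c * orient a b d < 0" "orient c d a * orient c d b < 0"
  shows "closed_segment a b \<inter> closed_segment c d \<noteq> {}"
proof -
  \<comment> \<open>\<open>orient a b\<close> is affine along the segment from \<open>c\<close> to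
    \<open>d\<close>, and \<open>s\<close> is the parameter of its zero; likewise \<open>r\<close>
    for \<open>orient c d\<close> on the other segment. Both give the common point of the two
    lines.\<close>
  define s where "s = orient a b c / (orient a b c - orient a b d)"
  define r where "r = orient c d a / (orient c d a - orient c d b)"
  have n: "orient a b c - orient a b d \<noteq> 0" "orient c d a - orient c d b \<noteq> 0"
    using assms by (auto simp: mult_less_0_iff)
  have s: "0 \<le> s" "s \<le> 1" and r: "0 \<le> r" "r \<le> 1"
    using assms by (auto simp: s_def r_def mult_less_0_iff divide_simps)
  have "(1 - r) *\<^sub>R a + r *\<^sub>R b = (1 - s) *\<^sub>R c + s *\<^sub>R d"
    using n unfolding s_def r_def
    by (simp add: prod_eq_iff divide_simps) (simp add: orient_def algebra_simps)
  moreover have "(1 - r) *\<^sub>R a + r *\<^sub>R b \<in> closed_segment a b"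
    "(1 - s) *\<^sub>R c + s *\<^sub>R d \<in> closed_segment c d"
    using s r unfolding in_segment by blast+
  ultimately show ?thesis by (metis IntI empty_iff)
qed

section \<open>Orientation signs and parities for points in general position\<close>

definition general_position :: "('v \<Rightarrow> real \<times> real) \<Rightarrow> 'v set \<Rightarrow> bool" where
  "general_position p V \<longleftrightarrow>
    (\<forall>u\<in>V. \<forall>v\<in>V. \<forall>w\<in>V. distinct [u, v, w] \<longrightarrow> orient (p u) (p v) (p w) \<noteq> 0)"

locale generic_points =
  fixes p :: "'v \<Rightarrow> real \<times> real" and V :: "'v set"
  assumes general: "general_position p V"
begin

definition ccw :: "'v \<Rightarrow> 'v \<Rightarrow> 'v \<Rightarrow> bool" where
  "ccw u v w \<longleftrightarrow> orient (p u) (p v) (p w) > 0"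

text \<open>Values in \<open>bit\<close> turn sums of these terms into parities. In general position
  two segments cross exactly when the line through each separates the ends of the other.\<close>

definition crossings :: "'v \<Rightarrow> 'v \<Rightarrow> 'v \<Rightarrow> 'v \<Rightarrow> bit" where
  "crossings u v x y = of_bool (ccw u v x \<noteq> ccw u v y \<and> ccw x y u \<noteq> ccw x y v)"

definition inside_triangle :: "'v \<Rightarrow> 'v \<Rightarrow> 'v \<Rightarrow> 'v \<Rightarrow> bit" where
  "inside_triangle u x y z = of_bool (ccw x y u = ccw y z u \<and> ccw y z u = ccw z x u)"

lemma ccw_rotate: "ccw v w u = ccw u v w"
  by (simp add: ccw_def orient_rotate)

lemma ccw_swap:
  assumes "{u, v, w} \<subseteq> V" "distinct [u, v, w]"
  shows "ccw v u w \<longleftrightarrow> \<not> ccw u v w"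
proof -
  have "orient (p u) (p v) (p w) \<noteq> 0" using general assms by (auto simp: general_position_def)
  then show ?thesis using orient_swap[of "p v" "p u" "p w"] by (auto simp: ccw_def)
qed

lemma ccw_perms:
  assumes "{u, v, w} \<subseteq> V" "distinct [u, v, w]"
  shows "ccw v w u = ccw u v w" "ccw w u v = ccw u v w" "ccw v u w \<longleftrightarrow> \<not> ccw u v w"
    "ccw u w v \<longleftrightarrow> \<not> ccw u v w" "ccw w v u \<longleftrightarrow> \<not> ccw u v w"
  using ccw_swap[OF assms] ccw_rotate by metis+

text \<open>If the three summands in \<open>orient_cocycle\<close> share a sign, their sum has it
  too.\<close>

lemma ccw_cocycle:
  assumes "{x, y, z, u} \<subseteq> V" "distinct [x, y, z, u]"
  shows "\<not> (ccw x y u = ccw y z u \<and> ccw y z u = ccw z x u \<and> ccw x y z \<noteq> ccw x y u)"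
proof -
  have "orient (p x) (p y) (p u) \<noteq> 0" "orient (p y) (p z) (p u) \<noteq> 0"
    "orient (p z) (p x) (p u) \<noteq> 0" "orient (p x) (p y) (p z) \<noteq> 0"
    using general assms by (auto simp: general_position_def)
  then show ?thesis using orient_cocycle[of "p x" "p y" "p z" "p u"] by (auto simp: ccw_def)
qed

text \<open>Two orientations agree exactly when their product is positive. If the two products on
  the left of \<open>orient_Pluecker\<close> have the same sign, so has the product on the
  right.\<close>

lemma ccw_Pluecker:
  assumes "{a, b, c, d, e} \<subseteq> V" "distinct [a, b, c, d, e]"
  shows "(ccw a b c = ccw a d e) = (ccw a b e = ccw a c d) \<Longrightarrow>
    (ccw a b d = ccw a c e) = (ccw a b e = ccw a c d)"
proof -
  have n: "orient (p a) (p b) (p c) \<noteq> 0" "orient (p a) (p d) (p e) \<noteq> 0"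
    "orient (p a) (p b) (p d) \<noteq> 0" "orient (p a) (p c) (p e) \<noteq> 0"
    "orient (p a) (p b) (p e) \<noteq> 0" "orient (p a) (p c) (p d) \<noteq> 0"
    using general assms by (auto simp: general_position_def)
  have *: "(s > 0) = (t > 0) \<longleftrightarrow> s * t > 0" if "s \<noteq> 0" "t \<noteq> 0" for s t :: real
    using that by (auto simp: zero_less_mult_iff)
  have **: "z * y > 0" if "x * y > 0" "x + y = z" for x y z :: real
    using that by (auto simp: zero_less_mult_iff)
  show "(ccw a b c = ccw a d e) = (ccw a b e = ccw a c d) \<Longrightarrow>
    (ccw a b d = ccw a c e) = (ccw a b e = ccw a c d)"
    unfolding ccw_def using n orient_Pluecker[of "p a" "p b" "p c" "p d" "p e"]
    by (simp add: * **)
qed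

lemma crossings_commute: "crossings x y u v = crossings u v x y"
  by (auto simp: crossings_def)

text \<open>A segment changes between inside and outside each time it crosses a side of the
  triangle.\<close>

lemma segment_triangle_parity:
  assumes "{u, v, x, y, z} \<subseteq> V" "distinct [u, v, x, y, z]"
  shows "crossings u v x y + crossings u v y z + crossings u v x z =
    inside_triangle u x y z + inside_triangle v x y z"
proof -
  have *: "{a, b, c} \<subseteq> V" "distinct [a, b, c]"
    if "(a, b, c) \<in> {(u, v, x), (u, v, y), (u, v, z), (u, x, y), (u, x, z), (u, y, z),
      (v, x, y), (v, x, z), (v, y, z), (x, y, z)}" for a b c
    using that assms by auto
  note perms = ccw_perms[OF *[of u v x]] ccw_perms[OF *[of u v y]] ccw_perms[OF *[of u v z]]
    ccw_perms[OF *[of u x y]] ccw_perms[OF *[of u x z]] ccw_perms[OF *[of u y z]]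
    ccw_perms[OF *[of v x y]] ccw_perms[OF *[of v x z]] ccw_perms[OF *[of v y z]]
    ccw_perms[OF *[of x y z]]
  note perms = perms[simplified]
  \<comment> \<open>One relation based at each of the five points. With all orientations reduced by
    \<open>perms\<close> to those of the ten triples, the claim becomes a finite check on ten
    signs.\<close>
  note P = ccw_Pluecker[of u v x y z] ccw_Pluecker[of v u x y z] ccw_Pluecker[of x u v y z]
    ccw_Pluecker[of y u v x z] ccw_Pluecker[of z u v x y]
  show ?thesis
    using P assms unfolding crossings_def inside_triangle_def perms
    by simp (smt (verit))
qed

text \<open>The bent edges are \<open>a m b\<close> and \<open>c n d\<close>. As \<open>c n\<close>
  and \<open>d n\<close> miss \<open>a m\<close> and \<open>b m\<close>, each crosses
  \<open>a b\<close> as often, modulo two, as it has ends inside the triangle \<open>a b m\<close>.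
  The contribution of \<open>n\<close> cancels, and the triangle \<open>c d n\<close> then yields
  the crossing of \<open>a b\<close> with \<open>c d\<close>.\<close>

lemma path_crossings_parity:
  assumes "{a, b, m, c, d, n} \<subseteq> V" "distinct [a, b, m, c, d, n]"
    and "crossings a m c n = 0" "crossings a m d n = 0"
      "crossings b m c n = 0" "crossings b m d n = 0"
  shows "crossings a b c d = inside_triangle c a b m + inside_triangle d a b m
    + inside_triangle a c d n + inside_triangle b c d n"
proof -
  have "crossings c d a b + crossings c d b m + crossings c d a m =
      inside_triangle c a b m + inside_triangle d a b m"
    "crossings a b c d + crossings a b d n + crossings a b c n =
      inside_triangle a c d n + inside_triangle b c d n"
    "crossings c n a b + crossings c n b m + crossings c n a m =
      inside_triangle c a b m + inside_triangle n a b m"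
    "crossings d n a b + crossings d n b m + crossings d n a m =
      inside_triangle d a b m + inside_triangle n a b m"
    using assms(1,2) by (intro segment_triangle_parity; auto)+
  then show ?thesis
    using assms(3-) crossings_commute[of c d a b] crossings_commute[of c n]
      crossings_commute[of d n]
    by (cases "inside_triangle c a b m"; cases "inside_triangle d a b m";
      cases "inside_triangle n a b m"; cases "inside_triangle a c d n";
      cases "inside_triangle b c d n") auto
qed

text \<open>Either the points are in convex position, with one crossing and no point inside a
  triangle, or one point lies inside the triangle of the others and nothing crosses.\<close>

lemma four_points_parity:
  assumes "{a, b, c, d} \<subseteq> V" "distinct [a, b, c, d]"
  shows "crossings a b c d + crossings a c b d + crossings a d b c =
    1 + inside_triangle a b c d + inside_triangle b a c d + inside_triangle c a b d
      + inside_triangle d a b c"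
proof -
  have "{a, b, c} \<subseteq> V" "{a, b, d} \<subseteq> V" "{a, c, d} \<subseteq> V" "{b, c, d} \<subseteq> V"
    "distinct [a, b, c]" "distinct [a, b, d]" "distinct [a, c, d]" "distinct [b, c, d]"
    using assms by auto
  note perms = ccw_perms[OF this(1,5)] ccw_perms[OF this(2,6)] ccw_perms[OF this(3,7)]
    ccw_perms[OF this(4,8)]
  \<comment> \<open>This excludes the sign patterns that no four points have; the others are checked
    one by one.\<close>
  have "\<not> (ccw a b d = ccw b c d \<and> ccw b c d = ccw c a d \<and> ccw a b c \<noteq> ccw a b d)"
    by (rule ccw_cocycle) (use assms in auto)
  then show ?thesis
    unfolding crossings_def inside_triangle_def perms
    by (cases "ccw a b c"; cases "ccw a b d"; cases "ccw a c d"; cases "ccw b c d") simp_all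
qed

text \<open>In the sum \<open>N\<close> below, taken over all triangles, each crossing pair of segments is counted twice,
  once for each segment as a side of a triangle.\<close>

lemma five_points_parity:
  assumes "{a, b, c, d, e} \<subseteq> V" "distinct [a, b, c, d, e]"
  shows "(crossings a b c d + crossings a c b d + crossings a d b c) +
    (crossings a b c e + crossings a c b e + crossings a e b c) +
    (crossings a b d e + crossings a d b e + crossings a e b d) +
    (crossings a c d e + crossings a d c e + crossings a e c d) +
    (crossings b c d e + crossings b d c e + crossings b e c d) = 1"
proof -
  define N where "N =
      (inside_triangle d a b c + inside_triangle e a b c) +
      (inside_triangle c a b d + inside_triangle e a b d) +
      (inside_triangle c a b e + inside_triangle d a b e) +
      (inside_triangle b a c d + inside_triangle e a c d) +
      (inside_triangle b a c e + inside_triangle d a c e) +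
      (inside_triangle b a d e + inside_triangle c a d e) +
      (inside_triangle a b c d + inside_triangle e b c d) +
      (inside_triangle a b c e + inside_triangle d b c e) +
      (inside_triangle a b d e + inside_triangle c b d e) +
      (inside_triangle a c d e + inside_triangle b c d e)"
  have cancel: "x + x = 0" "x + (x + y) = y" for x y :: bit
    by (cases x; cases y; simp)+
  have triangles:
    "inside_triangle d a b c + inside_triangle e a b c =
      crossings d e a b + crossings d e b c + crossings d e a c"
    "inside_triangle c a b d + inside_triangle e a b d =
      crossings c e a b + crossings c e b d + crossings c e a d"
    "inside_triangle c a b e + inside_triangle d a b e =
      crossings c d a b + crossings c d b e + crossings c d a e"
    "inside_triangle b a c d + inside_triangle e a c d =
      crossings b e a c + crossings b e c d + crossings b e a d"
    "inside_triangle b a c e + inside_triangle d a c e =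
      crossings b d a c + crossings b d c e + crossings b d a e"
    "inside_triangle b a d e + inside_triangle c a d e =
      crossings b c a d + crossings b c d e + crossings b c a e"
    "inside_triangle a b c d + inside_triangle e b c d =
      crossings a e b c + crossings a e c d + crossings a e b d"
    "inside_triangle a b c e + inside_triangle d b c e =
      crossings a d b c + crossings a d c e + crossings a d b e"
    "inside_triangle a b d e + inside_triangle c b d e =
      crossings a c b d + crossings a c d e + crossings a c b e"
    "inside_triangle a c d e + inside_triangle b c d e =
      crossings a b c d + crossings a b d e + crossings a b c e"
    by (rule segment_triangle_parity[symmetric]; use assms in auto)+
  have commute:
    "crossings c d a b = crossings a b c d" "crossings b d a c = crossings a c b d"
    "crossings b c a d = crossings a d b c" "crossings c e a b = crossings a b c e"
    "crossings b e a c = crossings a c b e" "crossings b c a e = crossings a e b c"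
    "crossings d e a b = crossings a b d e" "crossings b e a d = crossings a d b e"
    "crossings b d a e = crossings a e b d" "crossings d e a c = crossings a c d e"
    "crossings c e a d = crossings a d c e" "crossings c d a e = crossings a e c d"
    "crossings d e b c = crossings b c d e" "crossings c e b d = crossings b d c e"
    "crossings c d b e = crossings b e c d"
    by (rule crossings_commute)+
  have "N = 0"
    unfolding N_def triangles commute by (simp only: cancel add_ac add_0_right)
  \<comment> \<open>The five quadruples share out the twenty terms of \<open>N\<close>. These
    cancel, and five ones remain, which make 1 modulo two.\<close>
  moreover have quadruples:
    "crossings a b c d + crossings a c b d + crossings a d b c =
      1 + inside_triangle a b c d + inside_triangle b a c d +
        inside_triangle c a b d + inside_triangle d a b c"
    "crossings a b c e + crossings a c b e + crossings a e b c =
      1 + inside_triangle a b c e + inside_triangle b a c e +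
        inside_triangle c a b e + inside_triangle e a b c"
    "crossings a b d e + crossings a d b e + crossings a e b d =
      1 + inside_triangle a b d e + inside_triangle b a d e +
        inside_triangle d a b e + inside_triangle e a b d"
    "crossings a c d e + crossings a d c e + crossings a e c d =
      1 + inside_triangle a c d e + inside_triangle c a d e +
        inside_triangle d a c e + inside_triangle e a c d"
    "crossings b c d e + crossings b d c e + crossings b e c d =
      1 + inside_triangle b c d e + inside_triangle c b d e +
        inside_triangle d b c e + inside_triangle e b c d"
    by (rule four_points_parity; use assms in auto)+
  ultimately show ?thesis
    unfolding N_def quadruples by (simp only: cancel add_ac add_0_right)
qed

lemma crossings_eq_0:
  assumes "{u, v, x, y} \<subseteq> V" "distinct [u, v, x, y]"
    and "closed_segment (p u) (p v) \<inter> closed_segment (p x) (p y) = {}"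
  shows "crossings u v x y = 0"
proof -
  have "orient (p u) (p v) (p x) \<noteq> 0" "orient (p u) (p v) (p y) \<noteq> 0"
    "orient (p x) (p y) (p u) \<noteq> 0" "orient (p x) (p y) (p v) \<noteq> 0"
    using general assms by (auto simp: general_position_def)
  then show ?thesis
    using closed_segments_meet[of "p u" "p v" "p x" "p y"] assms(3)
    by (auto simp: crossings_def ccw_def mult_less_0_iff)
qed

end

section \<open>One layer does not suffice\<close>

text \<open>In the sum over the fifteen independent pairs of edges of \<open>K\<^sub>5\<close>, each term \<open>I i j r\<close> below
  occurs once for each of the two vertices outside \<open>{i, j, r}\<close>, hence an even number of times.\<close>

lemma subdivided_K5_crossing:
  fixes p :: "nat set \<Rightarrow> real \<times> real"
  assumes gp: "general_position p (verts (subdivided_complete_graph 5))"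
  shows "\<exists>i<5. \<exists>j<5. \<exists>r<5. \<exists>s<5. distinct [i, j, r, s] \<and>
    closed_segment (p {i}) (p {i, j}) \<inter> closed_segment (p {r}) (p {r, s}) \<noteq> {}"
proof (rule ccontr)
  assume "\<not> ?thesis"
  then have disjoint: "closed_segment (p {i}) (p {i, j}) \<inter> closed_segment (p {r}) (p {r, s}) = {}"
    if "distinct [i, j, r, s]" "{i, j, r, s} \<subseteq> {..<5}" for i j r s
    using that unfolding insert_subset lessThan_iff by blast
  define V where "V = verts (subdivided_complete_graph 5)"
  interpret generic_points p V
    using gp by unfold_locales (simp add: V_def)
  have vertex: "{i} \<in> V" if "i < 5" for i
    using that by (simp add: V_def verts_subdivided_complete_graph)
  have middle: "{i, j} \<in> V" if "i < 5" "j < 5" for i j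
    using that by (simp add: V_def verts_subdivided_complete_graph card_insert_if)
  have zero: "crossings {i} {i, j} {r} {r, s} = 0"
    if "distinct [i, j, r, s]" "{i, j, r, s} \<subseteq> {..<5}" for i j r s
    using that vertex middle by (intro crossings_eq_0 disjoint) (auto simp: doubleton_eq_iff)
  \<comment> \<open>Whether vertex \<open>r\<close> lies in the triangle between the bent edge
    \<open>i j\<close> and its straightening.\<close>
  define I where "I i j r = inside_triangle {r} {i} {j} {i, j}" for i j r
  have pair: "crossings {i} {j} {r} {s} = I i j r + I i j s + I r s i + I r s j"
    if "distinct [i, j, r, s]" "{i, j, r, s} \<subseteq> {..<5}" for i j r s
    unfolding I_def using that vertex middle
      zero[of i j r s] zero[of i j s r] zero[of j i r s] zero[of j i s r]
    by (intro path_crossings_parity) (auto simp: doubleton_eq_iff insert_commute)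
  have cancel: "x + x = 0" "x + (x + y) = y" for x y :: bit
    by (cases x; cases y; simp)+
  have "{{0}, {1}, {2}, {3}, {4}} \<subseteq> V" "distinct [{0}, {1}, {2}, {3}, {4 :: nat}]"
    using vertex by simp_all
  from five_points_parity[OF this] show False
    by (simp only: pair cancel add_ac distinct.simps list.set insert_iff empty_iff insert_subset
      empty_subsetI lessThan_iff rel_simps simp_thms if_True add_0_right zero_neq_one)
qed

section \<open>Perturbation into general position\<close>

lemma eventually_closed_segments_disjoint:
  fixes a b c d :: "'a::euclidean_space"
  assumes "closed_segment a b \<inter> closed_segment c d = {}"
    and "(f \<longlongrightarrow> a) F" "(g \<longlongrightarrow> b) F" "(h \<longlongrightarrow> c) F" "(k \<longlongrightarrow> d) F"
  shows "\<forall>\<^sub>F t in F. closed_segment (f t) (g t) \<inter> closed_segment (h t) (k t) = {}"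
proof -
  \<comment> \<open>Disjoint compact segments have a positive distance. If all ends move by less
    than \<open>e / 2\<close>, so does every point of either segment, and a gap remains.\<close>
  obtain e where e: "e > 0"
    "\<And>x y. x \<in> closed_segment a b \<Longrightarrow> y \<in> closed_segment c d \<Longrightarrow> e \<le> dist x y"
    using separate_compact_closed[of "closed_segment a b" "closed_segment c d"] assms(1) by auto
  have near: "\<exists>y\<in>closed_segment v w. dist x y < e / 2"
    if "dist v' v < e / 2" "dist w' w < e / 2" "x \<in> closed_segment v' w'" for v w v' w' x :: 'a
  proof -
    obtain u where u: "x = (1 - u) *\<^sub>R v' + u *\<^sub>R w'" "0 \<le> u" "u \<le> 1"
      using \<open>x \<in> _\<close> by (auto simp: in_segment)
    have "x - ((1 - u) *\<^sub>R v + u *\<^sub>R w) = (1 - u) *\<^sub>R (v' - v) + u *\<^sub>R (w' - w)"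
      by (simp add: u algebra_simps)
    then have "dist x ((1 - u) *\<^sub>R v + u *\<^sub>R w) \<le> (1 - u) * dist v' v + u * dist w' w"
      using norm_triangle_ineq[of "(1 - u) *\<^sub>R (v' - v)" "u *\<^sub>R (w' - w)"] u
      by (simp add: dist_norm)
    also have "\<dots> < e / 2" using that(1,2) u by (intro convex_bound_lt) auto
    finally show ?thesis using u
      by (intro bexI[of _ "(1 - u) *\<^sub>R v + u *\<^sub>R w"]) (auto simp: in_segment)
  qed
  have "\<forall>\<^sub>F t in F. dist (f t) a < e / 2 \<and> dist (g t) b < e / 2 \<and>
      dist (h t) c < e / 2 \<and> dist (k t) d < e / 2"
    using assms(2-) e(1) by (intro eventually_conj) (auto dest: tendstoD[of _ _ _ "e / 2"])
  then show ?thesis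
  proof eventually_elim
    case (elim t)
    show ?case
    proof (rule ccontr)
      assume "\<not> ?thesis"
      then obtain x where x: "x \<in> closed_segment (f t) (g t)" "x \<in> closed_segment (h t) (k t)" by auto
      obtain y z where "y \<in> closed_segment a b" "dist x y < e / 2"
        "z \<in> closed_segment c d" "dist x z < e / 2"
        using near[OF _ _ x(1)] near[OF _ _ x(2)] elim by metis
      then show False using e(2)[of y z] dist_triangle_half_r[of x y e z] by force
    qed
  qed
qed

text \<open>Moving the points along the parabola makes each orientation a quadratic polynomial in the
  time \<open>t\<close> whose leading coefficient is a Vandermonde determinant.\<close>

lemma eventually_general_position:
  fixes p :: "'v \<Rightarrow> real \<times> real" and h :: "'v \<Rightarrow> real"
  assumes "finite V" "inj_on h V"
  shows "\<forall>\<^sub>F t in at 0. general_position (\<lambda>v. p v + t *\<^sub>R (h v, (h v)\<^sup>2)) V"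
proof -
  let ?q = "\<lambda>t v. p v + t *\<^sub>R (h v, (h v)\<^sup>2)"
  have "\<forall>\<^sub>F t in at 0. distinct [u, v, w] \<longrightarrow> orient (?q t u) (?q t v) (?q t w) \<noteq> 0"
    if V: "u \<in> V" "v \<in> V" "w \<in> V" for u v w
  proof (cases "distinct [u, v, w]")
    case True
    define a where "a = (h v - h u) * (h w - h u) * (h w - h v)"
    define b where "b = (h v - h u) * (snd (p w) - snd (p u))
      + ((h w)\<^sup>2 - (h u)\<^sup>2) * (fst (p v) - fst (p u))
      - (h w - h u) * (snd (p v) - snd (p u))
      - ((h v)\<^sup>2 - (h u)\<^sup>2) * (fst (p w) - fst (p u))"
    define P where "P = [:orient (p u) (p v) (p w), b, a:]"
    have "a \<noteq> 0" using True V assms(2) by (auto simp: a_def inj_on_def)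
    then have "finite {t. poly P t = 0}" by (intro poly_roots_finite) (auto simp: P_def)
    then have "\<forall>\<^sub>F t in at 0. t \<notin> {t. poly P t = 0}"
      using islimpt_finite[of "{t. poly P t = 0}" 0] by (simp add: islimpt_iff_eventually)
    moreover have "orient (?q t u) (?q t v) (?q t w) = poly P t" for t
      unfolding orient_def P_def a_def b_def by (simp add: algebra_simps power2_eq_square)
    ultimately show ?thesis by simp
  qed (use that in auto)
  then show ?thesis
    unfolding general_position_def by (intro eventually_ball_finite ballI assms(1))
qed

text \<open>With fewer than two layers, independent edges of the complete graph on the first five
  vertices have disjoint halves. Small perturbations keep this and reach general position, against
  \<open>subdivided_K5_crossing\<close>.\<close>

lemma layering_subdivided_complete_graph_ge_2:
  assumes "k \<ge> 5" "layering (subdivided_complete_graph k) p t l"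
  shows "t \<ge> 2"
proof (rule ccontr)
  assume "\<not> t \<ge> 2"
  then have l: "l e = 0" if "e \<in> edges (subdivided_complete_graph k)" for e
    using assms(2) that by (force simp: layering_def)
  define V where "V = verts (subdivided_complete_graph 5)"
  have "finite V" by (simp add: V_def verts_subdivided_complete_graph)
  then obtain h :: "nat set \<Rightarrow> nat" where "inj_on h V"
    using finite_imp_inj_to_nat_seg by blast
  then have h: "inj_on (\<lambda>v. real (h v)) V" by (simp add: inj_on_def)
  let ?q = "\<lambda>t v. p v + t *\<^sub>R (real (h v), (real (h v))\<^sup>2)"
  have disjoint: "closed_segment (p {i}) (p {i, j}) \<inter> closed_segment (p {r}) (p {r, s}) = {}"
    if d: "distinct [i, j, r, s]" and "i < 5" "j < 5" "r < 5" "s < 5" for i j r s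
  proof -
    have edge: "{{x}, {x, y}} \<in> edges (subdivided_complete_graph k)"
      if "x < 5" "y < 5" "x \<noteq> y" for x y
    proof -
      have "{x, y} \<subseteq> {..<k} \<and> card {x, y} = 2" using that assms(1) by auto
      then show ?thesis
        unfolding subdivided_complete_graph_def subdivide_def complete_graph_def snd_conv by blast
    qed
    \<comment> \<open>Without a common end, every common point of the two segments is a
      crossing.\<close>
    have "{{i}, {i, j}} \<noteq> {{r}, {r, s}}" "{{i}, {i, j}} \<inter> {{r}, {r, s}} = {}"
      using d by (auto simp: doubleton_eq_iff)
    then show ?thesis
      using assms(2) l[OF edge[of i j]] l[OF edge[of r s]] edge[of i j] edge[of r s] that
      unfolding layering_def edges_cross_def edge_segment_pair[symmetric]
      by (metis all_not_in_conv disjoint_iff distinct_length_2_or_more image_empty)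
  qed
  have "\<forall>\<^sub>F t in at 0. \<forall>i\<in>{..<5}. \<forall>j\<in>{..<5}. \<forall>r\<in>{..<5}. \<forall>s\<in>{..<5}. distinct [i, j, r, s] \<longrightarrow>
    closed_segment (?q t {i}) (?q t {i, j}) \<inter> closed_segment (?q t {r}) (?q t {r, s}) = {}"
  proof (intro eventually_ball_finite ballI finite_lessThan)
    fix i j r s :: nat assume "i \<in> {..<5}" "j \<in> {..<5}" "r \<in> {..<5}" "s \<in> {..<5}"
    have tendsto: "((\<lambda>t. ?q t v) \<longlongrightarrow> p v) (at 0)" for v
      by (auto intro!: tendsto_eq_intros simp: zero_prod_def)
    show "\<forall>\<^sub>F t in at 0. distinct [i, j, r, s] \<longrightarrow>
      closed_segment (?q t {i}) (?q t {i, j}) \<inter> closed_segment (?q t {r}) (?q t {r, s}) = {}"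
      using disjoint[of i j r s] eventually_closed_segments_disjoint[OF _ tendsto tendsto tendsto tendsto]
        \<open>i \<in> _\<close> \<open>j \<in> _\<close> \<open>r \<in> _\<close> \<open>s \<in> _\<close> by (cases "distinct [i, j, r, s]") simp_all
  qed
  \<comment> \<open>Disjointness and general position both hold for all small nonzero
    \<open>t\<close>, yet no \<open>t\<close> admits both.\<close>
  then have "\<forall>\<^sub>F t in at (0 :: real). False"
    using eventually_general_position[OF \<open>finite V\<close> h, of p]
  proof eventually_elim
    case (elim t)
    then show ?case using subdivided_K5_crossing[of "?q t"] unfolding V_def by blast
  qed
  then show False by simp
qed

section \<open>Two layers suffice\<close>

text \<open>If \<open>s\<close> is the position of \<open>z\<close> on the way from \<open>c\<close>
  to \<open>a\<close>, the cross product of \<open>z - c\<close> and \<open>b - c\<close> is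
  \<open>s * orient c a b\<close>. It vanishes since \<open>z\<close> is on the second segment, so
  \<open>s = 0\<close>.\<close>

lemma closed_segments_common_end:
  assumes "z \<in> closed_segment c a" "z \<in> closed_segment c b" "orient c a b \<noteq> 0"
  shows "z = c"
proof -
  obtain s where s: "z = (1 - s) *\<^sub>R c + s *\<^sub>R a" using assms(1) by (auto simp: in_segment)
  obtain r where r: "z = (1 - r) *\<^sub>R c + r *\<^sub>R b" using assms(2) by (auto simp: in_segment)
  have "s * orient c a b = s * ((fst a - fst c) * (snd b - snd c) - (snd a - snd c) * (fst b - fst c))"
    by (simp add: orient_def)
  also have "\<dots> = (fst z - fst c) * (snd b - snd c) - (snd z - snd c) * (fst b - fst c)"
    unfolding s by (simp add: algebra_simps)
  also have "\<dots> = 0"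
    unfolding r by (simp add: algebra_simps)
  finally show ?thesis using assms(3) s by simp
qed

text \<open>The offsets of a middle vertex from \<open>(Min S, Max S)\<close> lie strictly between 0
  and 1, so rounding down recovers the pair. The first decreases in \<open>Max S\<close>, the second
  increases in \<open>Min S\<close>; this makes the slopes within each star strictly
  monotone.\<close>

definition grid_drawing :: "nat set \<Rightarrow> real \<times> real" where
  "grid_drawing S = (if card S = 1 then (Min S, Min S)
    else (Min S + 1 / (Max S + 1), Max S + (Min S + 1) / (Min S + 2)))"

lemma grid_drawing_singleton: "grid_drawing {i} = (i, i)"
  by (simp add: grid_drawing_def)

lemma grid_drawing_pair:
  "i < j \<Longrightarrow> grid_drawing {i, j} = (i + 1 / (j + 1), j + (i + 1) / (i + 2))"
  by (simp add: grid_drawing_def add.commute)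

lemmas grid_drawing_simps = grid_drawing_singleton grid_drawing_pair

lemma verts_subdivided_complete_graph_cases:
  assumes "S \<in> verts (subdivided_complete_graph k)"
  obtains (singleton) i where "S = {i}" | (pair) i j where "S = {i, j}" "i < j"
proof -
  consider "card S = 1" | "card S = 2" using assms by (auto simp: verts_subdivided_complete_graph)
  then show ?thesis
  proof cases
    case 1
    then show ?thesis using singleton card_1_singletonE by blast
  next
    case 2
    then obtain i j where "S = {i, j}" "i \<noteq> j" by (auto simp: card_2_iff)
    then show ?thesis
      using pair[of i j] pair[of j i] insert_commute[of i j "{}"]
      by (cases i j rule: linorder_cases) auto
  qed
qed

lemma edges_subdivided_complete_graph_cases:
  assumes "e \<in> edges (subdivided_complete_graph k)"
  obtains (lower) i j where "e = {{i}, {i, j}}" "i < j" | (upper) i j where "e = {{j}, {i, j}}" "i < j"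
proof -
  obtain v d where "e = {{v}, d}" "card d = 2" "v \<in> d"
    using assms by (auto simp: subdivided_complete_graph_def subdivide_def complete_graph_def)
  moreover from \<open>card d = 2\<close> \<open>v \<in> d\<close> obtain x where "d = {v, x}" "v \<noteq> x"
    by (auto simp: card_2_iff)
  ultimately have "e = {{v}, {v, x}}" "v \<noteq> x" by simp_all
  then show ?thesis
    using lower[of v x] upper[of v x] insert_commute[of v x "{}"]
    by (cases v x rule: linorder_cases) auto
qed

lemma floor_grid_drawing:
  assumes "S \<in> verts (subdivided_complete_graph k)"
  shows "\<lfloor>fst (grid_drawing S)\<rfloor> = Min S" "\<lfloor>snd (grid_drawing S)\<rfloor> = Max S"
  using assms
  by (auto elim!: verts_subdivided_complete_graph_cases
      simp: grid_drawing_simps floor_eq_iff divide_simps)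
    (simp_all add: algebra_simps)

lemma inj_on_grid_drawing: "inj_on grid_drawing (verts (subdivided_complete_graph k))"
proof (rule inj_onI)
  fix S T
  assume ST: "S \<in> verts (subdivided_complete_graph k)" "T \<in> verts (subdivided_complete_graph k)"
    and "grid_drawing S = grid_drawing T"
  then have "Min S = Min T" "Max S = Max T"
    using floor_grid_drawing[OF ST(1)] floor_grid_drawing[OF ST(2)] by simp_all
  moreover have "S = {Min S, Max S}" "T = {Min T, Max T}"
    using ST by (auto elim!: verts_subdivided_complete_graph_cases)
  ultimately show "S = T" by simp
qed

text \<open>The first coordinate only runs from \<open>i\<close> to \<open>i + 1 / (j + 1)\<close>.
  Hence a point of a lower edge determines the star it belongs to.\<close>

lemma floor_lower_edge:
  assumes "z \<in> closed_segment (grid_drawing {i}) (grid_drawing {i, j})" "i < j"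
  shows "\<lfloor>fst z\<rfloor> = i"
proof -
  obtain u where u: "fst z = i + u / (j + 1)" "0 \<le> u" "u \<le> 1"
    using assms by (auto simp: in_segment grid_drawing_simps algebra_simps add_divide_distrib)
  have "u / (j + 1) \<le> 1 / (j + 1)" using u by (intro divide_right_mono) auto
  also have "\<dots> < 1" using assms(2) by simp
  finally show ?thesis using u by (simp add: floor_eq_iff)
qed

lemma floor_upper_edge:
  assumes "z \<in> closed_segment (grid_drawing {j}) (grid_drawing {i, j})" "i < j"
  shows "\<lfloor>snd z\<rfloor> = j"
proof -
  obtain u where u: "snd z = j + u * ((i + 1) / (i + 2))" "0 \<le> u" "u \<le> 1"
    using assms by (auto simp: in_segment grid_drawing_simps algebra_simps)
  have "u * ((i + 1) / (i + 2)) \<le> 1 * ((i + 1) / (i + 2))"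
    using u by (intro mult_right_mono) auto
  also have "\<dots> < 1" by simp
  finally show ?thesis using u by (simp add: floor_eq_iff)
qed

text \<open>Different stars lie in disjoint strips, and edges of one star leave its centre in
  independent directions.\<close>

lemma lower_edges_meet:
  assumes "i < j" "i' < j'" "(i, j) \<noteq> (i', j')"
    and z: "z \<in> closed_segment (grid_drawing {i}) (grid_drawing {i, j})"
      "z \<in> closed_segment (grid_drawing {i'}) (grid_drawing {i', j'})"
  shows "i = i' \<and> z = grid_drawing {i}"
proof
  show "i = i'" using floor_lower_edge[OF z(1)] floor_lower_edge[OF z(2)] assms by simp
  have sign: "orient (grid_drawing {i}) (grid_drawing {i, a}) (grid_drawing {i, b}) > 0"
    if "i < a" "a < b" for a b
  proof -
    \<comment> \<open>Slopes compared after cross-multiplication: from \<open>a\<close> to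
      \<open>b\<close> the rise grows and the run shrinks.\<close>
    have "(a - i + (i + 1) / (i + 2)) * (1 / (b + 1)) < (b - i + (i + 1) / (i + 2)) * (1 / (real a + 1))"
      using that by (intro mult_strict_mono frac_less2 add_pos_pos) auto
    then show ?thesis using that by (simp add: orient_def grid_drawing_simps algebra_simps)
  qed
  have "orient (grid_drawing {i}) (grid_drawing {i, j}) (grid_drawing {i, j'}) \<noteq> 0"
    using assms(1-3) \<open>i = i'\<close> sign[of j j'] sign[of j' j]
      orient_swap_right[of "grid_drawing {i}" "grid_drawing {i, j}" "grid_drawing {i, j'}"]
    by (cases j j' rule: linorder_cases) auto
  then show "z = grid_drawing {i}"
    using z \<open>i = i'\<close> by (blast intro: closed_segments_common_end)
qed

lemma upper_edges_meet:
  assumes "i < j" "i' < j'" "(i, j) \<noteq> (i', j')"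
    and z: "z \<in> closed_segment (grid_drawing {j}) (grid_drawing {i, j})"
      "z \<in> closed_segment (grid_drawing {j'}) (grid_drawing {i', j'})"
  shows "j = j' \<and> z = grid_drawing {j}"
proof
  show "j = j'" using floor_upper_edge[OF z(1)] floor_upper_edge[OF z(2)] assms by simp
  have sign: "orient (grid_drawing {j}) (grid_drawing {a, j}) (grid_drawing {b, j}) < 0"
    if "a < b" "b < j" for a b
  proof -
    \<comment> \<open>Slopes again, now with the run to the left: from \<open>a\<close> to
      \<open>b\<close> the run shrinks and the rise grows.\<close>
    have "(real j - b - 1 / (real j + 1)) * ((real a + 1) / (real a + 2)) <
        (real j - a - 1 / (real j + 1)) * ((real b + 1) / (real b + 2))"
    proof (intro mult_strict_mono)
      show "(real a + 1) / (real a + 2) < (real b + 1) / (real b + 2)"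
        using that by (simp add: divide_simps) (simp add: algebra_simps)
      have "1 / (real j + 1) < 1" "real a + 1 \<le> j" using that by simp_all
      then show "0 < real j - a - 1 / (real j + 1)" by linarith
    qed (use that in auto)
    then show ?thesis using that by (simp add: orient_def grid_drawing_simps algebra_simps)
  qed
  have "orient (grid_drawing {j}) (grid_drawing {i, j}) (grid_drawing {i', j}) \<noteq> 0"
    using assms(1-3) \<open>j = j'\<close> sign[of i i'] sign[of i' i]
      orient_swap_right[of "grid_drawing {j}" "grid_drawing {i, j}" "grid_drawing {i', j}"]
    by (cases i i' rule: linorder_cases) auto
  then show "z = grid_drawing {j}"
    using z \<open>j = j'\<close> by (blast intro: closed_segments_common_end)
qed

text \<open>A middle vertex \<open>w\<close> is an end of one lower and one upper edge. Another edge
  through it would meet the one of its own kind, which puts \<open>w\<close> at the centre of a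
  star, against injectivity. For a singleton the floors suffice.\<close>

lemma straight_line_drawing_grid_drawing:
  "straight_line_drawing (subdivided_complete_graph k) grid_drawing"
  unfolding straight_line_drawing_def
proof (intro conjI ballI inj_on_grid_drawing notI)
  fix e w
  assume e: "e \<in> edges (subdivided_complete_graph k)"
    and w: "w \<in> verts (subdivided_complete_graph k) - e"
    and on: "grid_drawing w \<in> edge_segment grid_drawing e"
  have inj: False if "v \<in> e" "grid_drawing w = grid_drawing v" for v
  proof -
    have "v \<in> verts (subdivided_complete_graph k)"
      using e \<open>v \<in> e\<close> unfolding edges_subdivided_complete_graph by auto
    then show False
      using that w inj_on_grid_drawing[of k] by (auto dest: inj_onD)
  qed
  have w_verts: "w \<in> verts (subdivided_complete_graph k)" using w by blast
  from e show False
  proof (cases rule: edges_subdivided_complete_graph_cases)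
    case (lower i j)
    with on have on: "grid_drawing w \<in> closed_segment (grid_drawing {i}) (grid_drawing {i, j})"
      by (simp add: edge_segment_pair)
    from w_verts show False
    proof (cases rule: verts_subdivided_complete_graph_cases)
      case (singleton i')
      then show False using floor_lower_edge[OF on lower(2)] lower w by (simp add: grid_drawing_simps)
    next
      case (pair i' j')
      then have "grid_drawing w = grid_drawing {i}"
        using lower_edges_meet[OF lower(2) pair(2) _ on] lower w by auto
      then show False using inj lower by blast
    qed
  next
    case (upper i j)
    with on have on: "grid_drawing w \<in> closed_segment (grid_drawing {j}) (grid_drawing {i, j})"
      by (simp add: edge_segment_pair)
    from w_verts show False
    proof (cases rule: verts_subdivided_complete_graph_cases)
      case (singleton i')
      then show False using floor_upper_edge[OF on upper(2)] upper w by (simp add: grid_drawing_simps)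
    next
      case (pair i' j')
      then have "grid_drawing w = grid_drawing {j}"
        using upper_edges_meet[OF upper(2) pair(2) _ on] upper w by auto
      then show False using inj upper by blast
    qed
  qed
qed

definition lower_upper_layer :: "nat set set \<Rightarrow> nat" where
  "lower_upper_layer e = (if \<exists>i j. i < j \<and> e = {{i}, {i, j}} then 0 else 1)"

lemma lower_upper_layer_lower: "i < j \<Longrightarrow> lower_upper_layer {{i}, {i, j}} = 0"
  by (auto simp: lower_upper_layer_def)

lemma lower_upper_layer_upper: "i < j \<Longrightarrow> lower_upper_layer {{j}, {i, j}} = 1"
  by (auto simp: lower_upper_layer_def doubleton_eq_iff)

text \<open>Edges of one layer meet only at the centre of a common star, which is an end of both and
  hence no crossing.\<close>

lemma layering_grid_drawing:
  "layering (subdivided_complete_graph k) grid_drawing 2 lower_upper_layer"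
  unfolding layering_def
proof (intro conjI ballI impI notI; (elim conjE)?)
  show "lower_upper_layer e < 2" for e by (simp add: lower_upper_layer_def)
next
  fix e f
  assume e: "e \<in> edges (subdivided_complete_graph k)" and f: "f \<in> edges (subdivided_complete_graph k)"
    and "e \<noteq> f" and same: "lower_upper_layer e = lower_upper_layer f"
    and "edges_cross grid_drawing e f"
  then obtain z where z: "z \<in> edge_segment grid_drawing e" "z \<in> edge_segment grid_drawing f"
    "z \<notin> grid_drawing ` (e \<inter> f)" by (auto simp: edges_cross_def)
  from e show False
  proof (cases rule: edges_subdivided_complete_graph_cases)
    case e: (lower i j)
    then have "lower_upper_layer f = 0" using same by (simp add: lower_upper_layer_lower)
    then obtain i' j' where f: "f = {{i'}, {i', j'}}" "i' < j'"
      by (auto simp: lower_upper_layer_def split: if_splits)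
    have "i = i' \<and> z = grid_drawing {i}"
      using e f z \<open>e \<noteq> f\<close> by (intro lower_edges_meet[of i j i' j']) (auto simp: edge_segment_pair)
    then show False using e f z(3) by blast
  next
    case e: (upper i j)
    then have "lower_upper_layer f = 1" using same by (simp add: lower_upper_layer_upper)
    with f obtain i' j' where f: "f = {{j'}, {i', j'}}" "i' < j'"
      by (auto simp: lower_upper_layer_def elim!: edges_subdivided_complete_graph_cases split: if_splits)
    have "j = j' \<and> z = grid_drawing {j}"
      using e f z \<open>e \<noteq> f\<close> by (intro upper_edges_meet[of i j i' j']) (auto simp: edge_segment_pair)
    then show False using e f z(3) by blast
  qed
qed

theorem theorem1:
  fixes k :: nat
  assumes "k \<ge> 5"
  shows "geometric_thickness (subdivided_complete_graph k) = 2"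
  unfolding geometric_thickness_def
proof (rule Least_equality)
  show "\<exists>p l. straight_line_drawing (subdivided_complete_graph k) p \<and>
      layering (subdivided_complete_graph k) p 2 l"
    using straight_line_drawing_grid_drawing layering_grid_drawing by blast
  show "2 \<le> t" if "\<exists>p l. straight_line_drawing (subdivided_complete_graph k) p \<and>
      layering (subdivided_complete_graph k) p t l" for t
    using that layering_subdivided_complete_graph_ge_2[OF assms] by blast
qed

end
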